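(* Let $M\subseteq V$ and let $\{A,B,C\}$ be a partition of $M$. The table $\mathfrak{X}_{M}$ is strictly collapsible with respect to $\lambda_{B'}^{ABC}$, $\lambda_{C'}^{ABC}$ and $\lambda_{B'C'}^{ABC}$ for all nonempty $B'\subseteq B$ and $C'\subseteq C$, by collapsing over $\mathfrak{X}_{A}$ into $\mathfrak{X}_{BC}$, if and only if $X_{A}\perp\!\!\!\perp (X_{B},X_{C})$.
   Context: $V$ is a finite index set; for $v\in V$, $X_v$ is a categorical variable with finite level set $\mathfrak{X}_v=\{0,1,\dots,|\mathfrak{X}_v|-1\}$. For $A\subseteq V$, $X_A=(X_v)_{v\in A}$ and $\mathfrak{X}_A=\prod_{v\in A}\mathfrak{X}_v$ (with $|\mathfrak{X}_\emptyset|=1$); for $x\in\mathfrak{X}_A$ and $B\subseteq A$, $x_B$ is the restriction of $x$ to $B$. The joint distribution $p=p_V$ of $X_V$ on $\mathfrak{X}_V$ is strictly positive, and $p_A$ denotes its marginal on $\mathfrak{X}_A$. Juxtaposition denotes union: $ST=S\cup T$. The symbol $\subset$ denotes strict inclusion. For $L\subseteq M\subseteq V$ and $x_L\in\mathfrak{X}_L$, define $$\nu_L^M(x_L)=\frac{1}{|\mathfrak{X}_{M\setminus L}|}\sum_{j_M\in\mathfrak{X}_M:\,j_L=x_L}\log p_M(j_M),\qquad \lambda_L^M(x_L)=\sum_{L'\subseteq L}(-1)^{|L\setminus L'|}\nu_{L'}^M(x_{L'}).$$ $\lambda_L^M$ is called a marginal log-linear (MLL) parameter. For $\emptyset\ne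 L\subseteq K\subset M\subseteq V$, the table $\mathfrak{X}_M$ is strictly collapsible over $M\setminus K$ (also written: over $\mathfrak{X}_{M\setminus K}$) into $\mathfrak{X}_K$ with respect to $\lambda_L^M$ if (i) $\lambda_L^K(x_L)=\lambda_L^M(x_L)$ for all $x_L\in\mathfrak{X}_L$, and (ii) $\lambda_Z^M(x_Z)=0$ for all $x_Z\in\mathfrak{X}_Z$ and all $Z\subseteq M$ with $L\subset Z\not\subseteq K$. For a partition $\{A,B,C\}$ of $M$, $X_A\perp\!\!\!\perp (X_B,X_C)$ (joint independence) means $p_M(x_M)=p_A(x_A)\,p_{BC}(x_{BC})$ for all $x_M\in\mathfrak{X}_M$. *)

theory Defs
  imports "HOL-Probability.Probability" "HOL-Library.Disjoint_Sets"
begin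

text \<open>
  The variable \<open>X\<^sub>v\<close> has the \<open>k v\<close> levels \<open>0, \<dots>, k v - 1\<close>.  A cell of the table over \<open>A\<close> is an
  extensional function on \<open>A\<close>, so the restriction of \<open>x\<close> to \<open>B\<close> is \<open>restrict x B\<close> and the table over
  the empty set has exactly one cell.
\<close>

definition table :: "('v \<Rightarrow> nat) \<Rightarrow> 'v set \<Rightarrow> ('v \<Rightarrow> nat) set" where
  "table k A = (\<Pi>\<^sub>E v\<in>A. {..<k v})"

text \<open>
  A strictly positive joint distribution of \<open>X\<^sub>V\<close> is a probability mass function \<open>p\<close> on
  \<open>'v \<Rightarrow> nat\<close> with \<open>set_pmf p = table k V\<close>.
\<close>

definition marginal :: "('v \<Rightarrow> nat) pmf \<Rightarrow> 'v set \<Rightarrow> ('v \<Rightarrow> nat) pmf" where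
  "marginal p A = map_pmf (\<lambda>x. restrict x A) p"

lemma pmf_marginal:
  assumes "finite V" "set_pmf p = table k V"
  shows "pmf (marginal p A) x = (\<Sum>j | j \<in> table k V \<and> restrict j A = x. pmf p j)"
proof -
  have fin: "finite (set_pmf p)"
    using assms by (simp add: table_def finite_PiE)
  have "pmf (marginal p A) x = measure p ((\<lambda>j. restrict j A) -` {x})"
    by (simp add: marginal_def pmf_map)
  also have "\<dots> = measure p (((\<lambda>j. restrict j A) -` {x}) \<inter> set_pmf p)"
    by (simp add: measure_Int_set_pmf)
  also have "\<dots> = (\<Sum>j\<in>((\<lambda>j. restrict j A) -` {x}) \<inter> set_pmf p. pmf p j)"
    using fin by (intro measure_measure_pmf_finite) auto
  also have "((\<lambda>j. restrict j A) -` {x}) \<inter> set_pmf p = {j. j \<in> table k V \<and> restrict j A = x}"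
    using assms by auto
  finally show ?thesis .
qed

text \<open>\<open>mll_nu k p L M x\<close> and \<open>mll k p L M x\<close> are \<open>\<nu>\<close> and \<open>\<lambda>\<close> with subscript \<open>L\<close> and superscript \<open>M\<close>.\<close>

definition mll_nu ::
  "('v \<Rightarrow> nat) \<Rightarrow> ('v \<Rightarrow> nat) pmf \<Rightarrow> 'v set \<Rightarrow> 'v set \<Rightarrow> ('v \<Rightarrow> nat) \<Rightarrow> real" where
  "mll_nu k p L M x =
     1 / real (card (table k (M - L))) *
     (\<Sum>j | j \<in> table k M \<and> restrict j L = x. ln (pmf (marginal p M) j))"

definition mll ::
  "('v \<Rightarrow> nat) \<Rightarrow> ('v \<Rightarrow> nat) pmf \<Rightarrow> 'v set \<Rightarrow> 'v set \<Rightarrow> ('v \<Rightarrow> nat) \<Rightarrow> real" where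
  "mll k p L M x = (\<Sum>L'\<in>Pow L. (-1) ^ card (L - L') * mll_nu k p L' M (restrict x L'))"

text \<open>
  The table over \<open>M\<close> is strictly collapsible over \<open>M - K\<close> into the table over \<open>K\<close> with respect to
  \<open>mll k p L M\<close>.  This is meant for nonempty \<open>L \<subseteq> K \<subset> M\<close>.
\<close>

definition strictly_collapsible ::
  "('v \<Rightarrow> nat) \<Rightarrow> ('v \<Rightarrow> nat) pmf \<Rightarrow> 'v set \<Rightarrow> 'v set \<Rightarrow> 'v set \<Rightarrow> bool" where
  "strictly_collapsible k p M K L \<longleftrightarrow>
     (\<forall>x\<in>table k L. mll k p L K x = mll k p L M x) \<and>
     (\<forall>Z. Z \<subseteq> M \<and> L \<subset> Z \<and> \<not> Z \<subseteq> K \<longrightarrow> (\<forall>x\<in>table k Z. mll k p Z M x = 0))"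

text \<open>\<open>X\<^sub>A\<close> is independent of \<open>(X\<^sub>B, X\<^sub>C)\<close>; meant for pairwise disjoint \<open>A\<close>, \<open>B\<close>, \<open>C\<close>.\<close>

definition joint_indep ::
  "('v \<Rightarrow> nat) \<Rightarrow> ('v \<Rightarrow> nat) pmf \<Rightarrow> 'v set \<Rightarrow> 'v set \<Rightarrow> 'v set \<Rightarrow> bool" where
  "joint_indep k p A B C \<longleftrightarrow>
     (\<forall>x\<in>table k (A \<union> B \<union> C).
        pmf (marginal p (A \<union> B \<union> C)) x =
        pmf (marginal p A) (restrict x A) * pmf (marginal p (B \<union> C)) (restrict x (B \<union> C)))"

end

theory Submission
  imports Defs
begin

text \<open>
  Put \<open>K = B \<union> C\<close>.  For a fixed cell \<open>x\<close> the MLL parameter \<open>\<lambda>\<^sub>Z(x\<^sub>Z)\<close> is the Moebius transform, in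
  the set \<open>Z\<close>, of the averages \<open>\<nu>\<^sub>Z(x\<^sub>Z)\<close>, so both sides of the equivalence are statements
  about the log-linear expansion \<open>log p\<^sub>M(x) = \<Sum>\<^sub>Z \<lambda>\<^sub>Z(x\<^sub>Z)\<close> (\<open>sum_subset_moebius\<close>).

  A set \<open>Z \<subseteq> M\<close> that meets both \<open>A\<close> and \<open>K\<close> contains a one-element subset of \<open>B\<close> or of \<open>C\<close> strictly,
  and is not contained in \<open>K\<close>.  Hence clause (ii) of strict collapsibility, for all the sets in question,
  kills exactly the terms that mix \<open>A\<close> with \<open>K\<close>.  What remains of the expansion is a function of \<open>x\<^sub>A\<close> plus
  a function of \<open>x\<^sub>K\<close>; so \<open>p\<^sub>M\<close> is a product of such functions, and summing out either
  block identifies the factors with the marginals up to constants whose product is \<open>1\<close>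
  (\<open>product_form_marginals\<close>).

  Conversely, independence gives \<open>log p\<^sub>M(x) = log p\<^sub>A(x\<^sub>A) + log p\<^sub>K(x\<^sub>K)\<close>, and the transform is linear.
  Averaging a function of \<open>x\<^sub>N\<close> over the table \<open>M\<close> is the same as averaging it over the table
  \<open>N\<close> (\<open>cell_avg_project\<close>).  Therefore its transform at \<open>Z\<close> is the one computed in the table \<open>N\<close>
  if \<open>Z \<subseteq> N\<close> and vanishes otherwise, because a coordinate outside \<open>N\<close> pairs up the terms
  of the alternating sum with opposite signs.  For nonempty \<open>L \<subseteq> K\<close> only the summand \<open>log p\<^sub>K\<close> contributes, with the
  value \<open>\<lambda>\<^sub>L\<^sup>K\<close>, which is clause (i); for mixed \<open>Z\<close> neither contributes, which is clause (ii).
\<close>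

section \<open>The Moebius transform of a set function\<close>

definition subset_moebius :: "('v set \<Rightarrow> real) \<Rightarrow> 'v set \<Rightarrow> real" where
  "subset_moebius F Z = (\<Sum>L\<in>Pow Z. (-1) ^ card (Z - L) * F L)"

lemma subset_moebius_add: "subset_moebius (\<lambda>L. F L + G L) Z = subset_moebius F Z + subset_moebius G Z"
  by (simp add: subset_moebius_def distrib_left sum.distrib)

lemma subset_moebius_cong: "(\<And>L. L \<subseteq> Z \<Longrightarrow> F L = G L) \<Longrightarrow> subset_moebius F Z = subset_moebius G Z"
  unfolding subset_moebius_def by (intro sum.cong) auto

lemma sum_Pow_insert:
  fixes f :: "'v set \<Rightarrow> real"
  assumes "finite Z" "a \<notin> Z"
  shows "(\<Sum>L\<in>Pow (insert a Z). f L) = (\<Sum>L\<in>Pow Z. f L) + (\<Sum>L\<in>Pow Z. f (insert a L))"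
proof -
  have "inj_on (insert a) (Pow Z)"
    using assms(2) by (intro inj_onI) (metis Pow_iff insert_ident subsetD)
  then show ?thesis
    using assms unfolding Pow_insert
    by (subst sum.union_disjoint) (auto simp: sum.reindex)
qed

text \<open>
  The transform is an iterated difference: splitting the subsets according to whether they contain \<open>a\<close>
  takes the difference in the direction of \<open>a\<close>.
\<close>
lemma subset_moebius_insert:
  assumes "finite Z" "a \<notin> Z"
  shows "subset_moebius F (insert a Z) = subset_moebius (\<lambda>L. F (insert a L)) Z - subset_moebius F Z"
proof -
  have "(\<Sum>L\<in>Pow Z. (-1) ^ card (insert a Z - L) * F L) = - subset_moebius F Z"
    unfolding subset_moebius_def sum_negf[symmetric]
  proof (intro sum.cong refl)
    fix L assume "L \<in> Pow Z"
    then have "a \<notin> Z - L" "insert a Z - L = insert a (Z - L)"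
      using assms(2) by auto
    then show "(-1) ^ card (insert a Z - L) * F L = - ((-1) ^ card (Z - L) * F L)"
      using assms(1) by simp
  qed
  moreover have "insert a Z - insert a L = Z - L" if "L \<in> Pow Z" for L
    using that assms(2) by auto
  then have "(\<Sum>L\<in>Pow Z. (-1) ^ card (insert a Z - insert a L) * F (insert a L))
      = subset_moebius (\<lambda>L. F (insert a L)) Z"
    unfolding subset_moebius_def by (intro sum.cong) auto
  ultimately show ?thesis
    using sum_Pow_insert[OF assms, of "\<lambda>L. (-1) ^ card (insert a Z - L) * F L"]
    by (simp add: subset_moebius_def)
qed

lemma subset_moebius_eq_0:
  assumes "finite Z" "a \<in> Z" and "\<And>L. L \<subseteq> Z \<Longrightarrow> F (insert a L) = F L"
  shows "subset_moebius F Z = 0"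
proof -
  have "subset_moebius F (insert a (Z - {a})) = 0"
    using assms by (subst subset_moebius_insert) (auto intro!: subset_moebius_cong)
  then show ?thesis
    using assms(2) by (simp add: insert_absorb)
qed

text \<open>
  Moebius inversion on the subsets of a finite set.  In the step from \<open>M\<close> to \<open>insert a M\<close> the terms for
  \<open>Z\<close> and \<open>insert a Z\<close> telescope to the transform of \<open>\<lambda>L. F (insert a L)\<close> at \<open>Z\<close>, which is why the
  induction has to range over all set functions.
\<close>
lemma sum_subset_moebius:
  assumes "finite M"
  shows "(\<Sum>Z\<in>Pow M. subset_moebius F Z) = F M"
  using assms
proof (induction M arbitrary: F rule: finite_induct)
  case empty
  show ?case by (simp add: subset_moebius_def)
next
  case (insert a M)
  have "subset_moebius F (insert a Z) = subset_moebius (\<lambda>L. F (insert a L)) Z - subset_moebius F Z" if "Z \<in> Pow M" for Z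
    using that insert.hyps by (intro subset_moebius_insert) (auto intro: finite_subset)
  then show ?case
    using sum_Pow_insert[OF insert.hyps] insert.IH[of "\<lambda>L. F (insert a L)"]
    by (simp add: sum_subtractf)
qed

section \<open>Sums over tables\<close>

lemma finite_table: "finite A \<Longrightarrow> finite (table k A)"
  by (simp add: table_def finite_PiE)

lemma table_nonempty_subset:
  assumes "table k M \<noteq> {}" "N \<subseteq> M"
  shows "table k N \<noteq> {}"
proof -
  have "\<And>v. v \<in> M \<Longrightarrow> {..<k v} \<noteq> {}"
    using assms(1) unfolding table_def PiE_eq_empty_iff by blast
  then show ?thesis
    using assms(2) unfolding table_def PiE_eq_empty_iff by blast
qed

lemma restrict_table: "x \<in> table k M \<Longrightarrow> L \<subseteq> M \<Longrightarrow> restrict x L \<in> table k L"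
  by (auto simp: table_def)

lemma restrict_table_id: "x \<in> table k M \<Longrightarrow> restrict x M = x"
  unfolding table_def by (rule extensional_restrict) (auto simp: PiE_def)

lemma merge_table: "x \<in> table k D \<Longrightarrow> y \<in> table k E \<Longrightarrow> merge D E (x, y) \<in> table k (D \<union> E)"
  by (auto simp: table_def merge_def PiE_def extensional_def)

lemma sum_fibre_table:
  fixes f :: "('v \<Rightarrow> nat) \<Rightarrow> real"
  assumes "D \<inter> E = {}" "x \<in> table k D"
  shows "(\<Sum>j | j \<in> table k (D \<union> E) \<and> restrict j D = x. f j) = (\<Sum>y\<in>table k E. f (merge D E (x, y)))"
proof (rule sum.reindex_bij_witness[where i = "\<lambda>y. merge D E (x, y)" and j = "\<lambda>j. restrict j E"])
  fix j assume "j \<in> {j. j \<in> table k (D \<union> E) \<and> restrict j D = x}"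
  then have j: "j \<in> table k (D \<union> E)" and x: "x = restrict j D"
    by auto
  have "j v = undefined" if "v \<notin> D" "v \<notin> E" for v
    using j that by (auto simp: table_def PiE_def extensional_def)
  then show *: "merge D E (x, restrict j E) = j"
    by (auto simp: x merge_def fun_eq_iff)
  show "restrict j E \<in> table k E"
    using j by (rule restrict_table) simp
  show "f (merge D E (x, restrict j E)) = f j"
    by (simp only: *)
next
  fix y assume y: "y \<in> table k E"
  show "restrict (merge D E (x, y)) E = y"
    using assms(1) restrict_table_id[OF y] by simp
  show "merge D E (x, y) \<in> {j. j \<in> table k (D \<union> E) \<and> restrict j D = x}"
    using assms merge_table[OF assms(2) y] restrict_table_id[OF assms(2)]
    by simp
qed

lemma sum_table_union:
  fixes f :: "('v \<Rightarrow> nat) \<Rightarrow> real"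
  assumes "finite (D \<union> E)" "D \<inter> E = {}"
  shows "(\<Sum>j\<in>table k (D \<union> E). f j) = (\<Sum>x\<in>table k D. \<Sum>y\<in>table k E. f (merge D E (x, y)))"
proof -
  have "(\<Sum>j\<in>table k (D \<union> E). f j) =
      (\<Sum>x\<in>table k D. \<Sum>j | j \<in> table k (D \<union> E) \<and> restrict j D = x. f j)"
    using assms by (intro sum.group[symmetric]) (auto intro: finite_table restrict_table)
  also have "\<dots> = (\<Sum>x\<in>table k D. \<Sum>y\<in>table k E. f (merge D E (x, y)))"
    using assms(2) by (intro sum.cong refl sum_fibre_table)
  finally show ?thesis .
qed

lemma average_table_restrict:
  fixes h :: "('v \<Rightarrow> nat) \<Rightarrow> real"
  assumes "finite N" "E \<subseteq> N" "table k N \<noteq> {}"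
  shows "(\<Sum>y\<in>table k N. h (restrict y E)) / card (table k N) = (\<Sum>z\<in>table k E. h z) / card (table k E)"
proof -
  have N: "N = E \<union> (N - E)"
    using assms(2) by auto
  have sum: "(\<Sum>y\<in>table k N. h (restrict y E)) = card (table k (N - E)) * (\<Sum>z\<in>table k E. h z)"
    for h :: "('v \<Rightarrow> nat) \<Rightarrow> real"
  proof -
    have "(\<Sum>y\<in>table k (E \<union> (N - E)). h (restrict y E)) =
        (\<Sum>z\<in>table k E. \<Sum>w\<in>table k (N - E). h (restrict z E))"
      using assms by (subst sum_table_union) (auto simp: finite_subset)
    also have "\<dots> = card (table k (N - E)) * (\<Sum>z\<in>table k E. h z)"
      by (simp add: restrict_table_id sum_distrib_left cong: sum.cong)
    finally show ?thesis
      using N by simp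
  qed
  have card: "real (card (table k N)) = card (table k (N - E)) * card (table k E)"
    using sum[of "\<lambda>_. 1"] by simp
  have "card (table k (N - E)) \<noteq> 0"
    using assms table_nonempty_subset[of k N "N - E"] by (simp add: finite_table)
  then show ?thesis
    unfolding sum card by simp
qed

section \<open>Interaction terms of functions on a table\<close>

text \<open>
  The functions \<open>\<nu>\<close> and \<open>\<lambda>\<close> with \<open>log p\<^sub>M\<close> replaced by an arbitrary function \<open>f\<close>, so that \<open>log p\<^sub>M\<close> can be split
  into summands that are not logarithms of distributions on \<open>M\<close>.
\<close>
definition cell_avg ::
  "('v \<Rightarrow> nat) \<Rightarrow> (('v \<Rightarrow> nat) \<Rightarrow> real) \<Rightarrow> 'v set \<Rightarrow> 'v set \<Rightarrow> ('v \<Rightarrow> nat) \<Rightarrow> real" where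
  "cell_avg k f L M x =
     (\<Sum>j | j \<in> table k M \<and> restrict j L = x. f j) / card (table k (M - L))"

definition interaction ::
  "('v \<Rightarrow> nat) \<Rightarrow> (('v \<Rightarrow> nat) \<Rightarrow> real) \<Rightarrow> 'v set \<Rightarrow> 'v set \<Rightarrow> ('v \<Rightarrow> nat) \<Rightarrow> real" where
  "interaction k f L M x = subset_moebius (\<lambda>L'. cell_avg k f L' M (restrict x L')) L"

lemma mll_eq_interaction: "mll k p L M = interaction k (\<lambda>j. ln (pmf (marginal p M) j)) L M"
  by (simp add: fun_eq_iff mll_def mll_nu_def interaction_def cell_avg_def subset_moebius_def)

lemma interaction_cong:
  "(\<And>j. j \<in> table k M \<Longrightarrow> f j = g j) \<Longrightarrow> interaction k f L M x = interaction k g L M x"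
  by (auto simp: interaction_def cell_avg_def intro!: subset_moebius_cong sum.cong)

lemma interaction_add:
  "interaction k (\<lambda>j. f j + g j) L M x = interaction k f L M x + interaction k g L M x"
  by (simp add: interaction_def cell_avg_def sum.distrib add_divide_distrib subset_moebius_add)

text \<open>With all of \<open>M\<close> fixed, only the cell \<open>x\<close> is averaged; so inversion expands \<open>f\<close> itself.\<close>
lemma sum_interaction:
  assumes "finite M" "x \<in> table k M"
  shows "(\<Sum>Z\<in>Pow M. interaction k f Z M (restrict x Z)) = f x"
proof -
  have "interaction k f Z M (restrict x Z) = subset_moebius (\<lambda>L. cell_avg k f L M (restrict x L)) Z" for Z
    unfolding interaction_def by (intro subset_moebius_cong) (simp add: Int_absorb1)
  then have "(\<Sum>Z\<in>Pow M. interaction k f Z M (restrict x Z)) = cell_avg k f M M (restrict x M)"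
    using assms(1) by (simp add: sum_subset_moebius)
  also have "{j. j \<in> table k M \<and> restrict j M = restrict x M} = {x}"
    using assms(2) by (auto simp: restrict_table_id)
  then have "cell_avg k f M M (restrict x M) = f x"
    by (simp add: cell_avg_def table_def)
  finally show ?thesis .
qed

text \<open>
  Once the coordinates in \<open>L\<close> are fixed, a function of the coordinates in \<open>K\<close> sees only those in
  \<open>K - L\<close>, and the remaining coordinates average out.
\<close>
lemma cell_avg_project:
  assumes "finite M" "K \<subseteq> M" "L \<subseteq> M" "table k M \<noteq> {}" "x \<in> table k L"
  shows "cell_avg k (\<lambda>j. g (restrict j K)) L M x = cell_avg k g (L \<inter> K) K (restrict x (L \<inter> K))"
proof -
  define h where "h z = g (merge (L \<inter> K) (K - L) (restrict x (L \<inter> K), z))" for z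
  have M: "M = L \<union> (M - L)" and K: "K = (L \<inter> K) \<union> (K - L)"
    using assms(3) by auto
  have "(\<Sum>j | j \<in> table k (L \<union> (M - L)) \<and> restrict j L = x. g (restrict j K)) =
      (\<Sum>y\<in>table k (M - L). g (restrict (merge L (M - L) (x, y)) K))"
    using assms(5) by (intro sum_fibre_table) auto
  also have "\<dots> = (\<Sum>y\<in>table k (M - L). h (restrict y (K - L)))"
  proof (intro sum.cong refl)
    fix y
    have "restrict (merge L (M - L) (x, y)) K =
        merge (L \<inter> K) (K - L) (restrict x (L \<inter> K), restrict y (K - L))"
      using assms(2) by (auto simp: merge_def restrict_def fun_eq_iff)
    then show "g (restrict (merge L (M - L) (x, y)) K) = h (restrict y (K - L))"
      by (simp add: h_def)
  qed
  finally have "cell_avg k (\<lambda>j. g (restrict j K)) L M x =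
      (\<Sum>y\<in>table k (M - L). h (restrict y (K - L))) / card (table k (M - L))"
    using M by (simp add: cell_avg_def)
  also have "\<dots> = (\<Sum>z\<in>table k (K - L). h z) / card (table k (K - L))"
    using assms table_nonempty_subset[of k M "M - L"] by (intro average_table_restrict) auto
  also have "(\<Sum>z\<in>table k (K - L). h z) =
      (\<Sum>j | j \<in> table k (L \<inter> K \<union> (K - L)) \<and> restrict j (L \<inter> K) = restrict x (L \<inter> K). g j)"
    unfolding h_def
    by (intro sum_fibre_table[symmetric] restrict_table[OF assms(5)]) auto
  also have "\<dots> / card (table k (K - L)) = cell_avg k g (L \<inter> K) K (restrict x (L \<inter> K))"
    using K by (simp add: cell_avg_def Diff_Int2 Diff_Int)
  finally show ?thesis .
qed

lemma interaction_project:
  assumes "finite M" "K \<subseteq> M" "L \<subseteq> M" "table k M \<noteq> {}" "x \<in> table k L"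
  shows "interaction k (\<lambda>j. g (restrict j K)) L M x =
    subset_moebius (\<lambda>L'. cell_avg k g (L' \<inter> K) K (restrict x (L' \<inter> K))) L"
  unfolding interaction_def
proof (intro subset_moebius_cong)
  fix L' assume L': "L' \<subseteq> L"
  have "cell_avg k (\<lambda>j. g (restrict j K)) L' M (restrict x L') =
      cell_avg k g (L' \<inter> K) K (restrict (restrict x L') (L' \<inter> K))"
    using assms L' by (intro cell_avg_project restrict_table[OF assms(5)]) auto
  then show "cell_avg k (\<lambda>j. g (restrict j K)) L' M (restrict x L') =
      cell_avg k g (L' \<inter> K) K (restrict x (L' \<inter> K))"
    by (simp add: Int_absorb1 Int_assoc[symmetric])
qed

lemma interaction_project_subset:
  assumes "finite M" "K \<subseteq> M" "L \<subseteq> K" "table k M \<noteq> {}" "x \<in> table k L"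
  shows "interaction k (\<lambda>j. g (restrict j K)) L M x = interaction k g L K x"
proof -
  have "L' \<inter> K = L'" if "L' \<subseteq> L" for L'
    using that assms(3) by auto
  then show ?thesis
    using assms by (subst interaction_project) (auto simp: interaction_def intro!: subset_moebius_cong)
qed

text \<open>A coordinate \<open>a \<in> L - K\<close> is averaged out in every term, so adding it to \<open>L'\<close> only flips the sign.\<close>
lemma interaction_project_eq_0:
  assumes "finite M" "K \<subseteq> M" "L \<subseteq> M" "\<not> L \<subseteq> K" "table k M \<noteq> {}" "x \<in> table k L"
  shows "interaction k (\<lambda>j. g (restrict j K)) L M x = 0"
proof -
  obtain a where "a \<in> L" "a \<notin> K"
    using assms(4) by auto
  then show ?thesis
    using assms
    by (subst interaction_project) (auto intro!: subset_moebius_eq_0[of _ a] intro: finite_subset)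
qed

section \<open>Marginal distributions\<close>

lemma marginal_marginal: "N \<subseteq> M \<Longrightarrow> marginal (marginal p M) N = marginal p N"
  by (simp add: marginal_def pmf.map_comp o_def Int_absorb1)

lemma set_pmf_marginal:
  assumes "set_pmf p = table k V" "M \<subseteq> V"
  shows "set_pmf (marginal p M) = table k M"
proof -
  have "x \<in> (\<lambda>j. restrict j M) ` table k V" if x: "x \<in> table k M" for x
  proof -
    have "table k V \<noteq> {}"
      using assms(1) set_pmf_not_empty by metis
    then have "table k (V - M) \<noteq> {}"
      by (rule table_nonempty_subset) simp
    then obtain y where "y \<in> table k (V - M)"
      by auto
    moreover have "M \<union> (V - M) = V"
      using assms(2) by auto
    ultimately have "merge M (V - M) (x, y) \<in> table k V"
      using merge_table[OF x, of y "V - M"] by simp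
    moreover have "restrict (merge M (V - M) (x, y)) M = x"
      using restrict_table_id[OF x] by simp
    ultimately show ?thesis
      by (metis image_eqI)
  qed
  then show ?thesis
    using assms by (auto simp: marginal_def intro: restrict_table)
qed

text \<open>
  Summing out \<open>E\<close> gives \<open>G\<close> times the total \<open>h\<close> of \<open>H\<close>, summing out \<open>D\<close> gives \<open>H\<close> times the total \<open>g\<close> of
  \<open>G\<close>, and \<open>g * h = 1\<close> because \<open>q\<close> has total mass one.
\<close>
lemma product_form_marginals:
  fixes G H :: "('v \<Rightarrow> nat) \<Rightarrow> real"
  assumes fin: "finite (D \<union> E)" and disj: "D \<inter> E = {}"
    and q: "set_pmf q = table k (D \<union> E)"
    and prod: "\<And>x. x \<in> table k (D \<union> E) \<Longrightarrow> pmf q x = G (restrict x D) * H (restrict x E)"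
    and x: "x \<in> table k (D \<union> E)"
  shows "pmf q x = pmf (marginal q D) (restrict x D) * pmf (marginal q E) (restrict x E)"
proof -
  define g where "g = (\<Sum>z\<in>table k D. G z)"
  define h where "h = (\<Sum>z\<in>table k E. H z)"
  have merge: "pmf q (merge D E (u, w)) = G u * H w" if "u \<in> table k D" "w \<in> table k E" for u w
    using prod[OF merge_table[OF that]] disj that by (simp add: restrict_table_id)
  have D: "pmf (marginal q D) u = G u * h" if "u \<in> table k D" for u
    using that disj
    by (simp add: pmf_marginal[OF fin q] sum_fibre_table merge h_def sum_distrib_left)
  have E: "pmf (marginal q E) w = H w * g" if w: "w \<in> table k E" for w
  proof -
    have "pmf (marginal q E) w = (\<Sum>j | j \<in> table k (E \<union> D) \<and> restrict j E = w. pmf q j)"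
      by (simp add: pmf_marginal[OF fin q] Un_commute)
    also have "\<dots> = (\<Sum>u\<in>table k D. pmf q (merge D E (u, w)))"
      using w disj by (subst sum_fibre_table) (simp_all add: Int_commute merge_commute[OF disj])
    also have "\<dots> = H w * g"
      using w by (simp add: merge g_def sum_distrib_left mult.commute)
    finally show ?thesis .
  qed
  have "1 = (\<Sum>j\<in>table k (D \<union> E). pmf q j)"
    using sum_pmf_eq_1[of "table k (D \<union> E)" q] fin q by (simp add: finite_table)
  also have "\<dots> = (\<Sum>u\<in>table k D. \<Sum>w\<in>table k E. G u * H w)"
    using fin disj by (simp add: sum_table_union merge)
  also have "\<dots> = g * h"
    by (simp add: g_def h_def sum_product)
  finally have "g * h = 1" by simp
  moreover have "restrict x D \<in> table k D" "restrict x E \<in> table k E"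
    using x by (auto intro: restrict_table)
  ultimately show ?thesis
    using prod[OF x] by (simp add: D E algebra_simps)
qed

section \<open>Strict collapsibility and independence of two blocks\<close>

text \<open>
  A nonempty \<open>L \<subseteq> K\<close> has points outside \<open>A\<close>, so no \<open>Z \<supseteq> L\<close> lies in \<open>A\<close>, and
  \<open>log p\<^sub>A\<close> contributes to none of the parameters that strict collapsibility speaks about.
\<close>
lemma independent_blocks_imp_strictly_collapsible:
  assumes fin: "finite (A \<union> K)" and disj: "A \<inter> K = {}"
    and p: "set_pmf (marginal p (A \<union> K)) = table k (A \<union> K)"
    and indep: "\<And>x. x \<in> table k (A \<union> K) \<Longrightarrow> pmf (marginal p (A \<union> K)) x =
      pmf (marginal p A) (restrict x A) * pmf (marginal p K) (restrict x K)"
    and L: "L \<noteq> {}" "L \<subseteq> K"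
  shows "strictly_collapsible k p (A \<union> K) K L"
proof -
  let ?a = "\<lambda>j. ln (pmf (marginal p A) j)" and ?b = "\<lambda>j. ln (pmf (marginal p K) j)"
  have ne: "table k (A \<union> K) \<noteq> {}"
    using p set_pmf_not_empty by metis
  have ln: "ln (pmf (marginal p (A \<union> K)) j) = ?a (restrict j A) + ?b (restrict j K)"
    if j: "j \<in> table k (A \<union> K)" for j
  proof -
    have "pmf (marginal p (A \<union> K)) j \<noteq> 0"
      using j p by (simp add: set_pmf_iff[symmetric])
    then show ?thesis
      using indep[OF j] by (simp add: ln_mult less_le)
  qed
  have split: "mll k p Z (A \<union> K) x =
      interaction k (\<lambda>j. ?a (restrict j A)) Z (A \<union> K) x +
      interaction k (\<lambda>j. ?b (restrict j K)) Z (A \<union> K) x" for Z x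
    unfolding mll_eq_interaction interaction_add[symmetric] by (intro interaction_cong ln)
  have a: "interaction k (\<lambda>j. ?a (restrict j A)) Z (A \<union> K) x = 0"
    if "L \<subseteq> Z" "Z \<subseteq> A \<union> K" "x \<in> table k Z" for Z x
  proof -
    have "\<not> Z \<subseteq> A"
      using that(1) L disj by blast
    then show ?thesis
      using that fin ne by (intro interaction_project_eq_0) auto
  qed
  have "mll k p L K x = mll k p L (A \<union> K) x" if "x \<in> table k L" for x
    using that fin ne L interaction_project_subset[of "A \<union> K" K L k x ?b]
    by (subst split) (simp add: a mll_eq_interaction le_supI2)
  moreover have "mll k p Z (A \<union> K) x = 0"
    if "Z \<subseteq> A \<union> K" "L \<subset> Z" "\<not> Z \<subseteq> K" "x \<in> table k Z" for Z x
    using that fin ne interaction_project_eq_0[of "A \<union> K" K Z k x ?b]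
    by (subst split) (simp add: a less_imp_le)
  ultimately show ?thesis
    by (simp add: strictly_collapsible_def)
qed

text \<open>
  Exponentiating the expansion of \<open>log p\<^sub>M\<close> turns its two remaining groups of terms into the factors
  that \<open>product_form_marginals\<close> asks for.
\<close>
lemma no_mixed_interaction_imp_independent_blocks:
  assumes fin: "finite (A \<union> K)" and disj: "A \<inter> K = {}"
    and p: "set_pmf (marginal p (A \<union> K)) = table k (A \<union> K)"
    and mixed: "\<And>Z x. Z \<subseteq> A \<union> K \<Longrightarrow> \<not> Z \<subseteq> A \<Longrightarrow> \<not> Z \<subseteq> K \<Longrightarrow> x \<in> table k Z \<Longrightarrow>
      mll k p Z (A \<union> K) x = 0"
    and x: "x \<in> table k (A \<union> K)"
  shows "pmf (marginal p (A \<union> K)) x =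
    pmf (marginal p A) (restrict x A) * pmf (marginal p K) (restrict x K)"
proof -
  let ?M = "A \<union> K" and ?q = "marginal p (A \<union> K)"
  let ?l = "\<lambda>x Z. mll k p Z ?M (restrict x Z)"
  \<comment> \<open>The constant term, for the empty set, is counted with the block \<open>A\<close>.\<close>
  define G where "G x = exp (\<Sum>Z\<in>Pow A. ?l x Z)" for x
  define H where "H x = exp (\<Sum>Z\<in>Pow K - {{}}. ?l x Z)" for x
  have "pmf ?q x = G (restrict x A) * H (restrict x K)" if x: "x \<in> table k ?M" for x
  proof -
    have "ln (pmf ?q x) = (\<Sum>Z\<in>Pow ?M. ?l x Z)"
      unfolding mll_eq_interaction using fin x by (rule sum_interaction[symmetric])
    also have "\<dots> = (\<Sum>Z\<in>Pow A \<union> (Pow K - {{}}). ?l x Z)"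
      using fin x by (intro sum.mono_neutral_right) (auto intro!: mixed intro: restrict_table)
    also have "\<dots> = (\<Sum>Z\<in>Pow A. ?l x Z) + (\<Sum>Z\<in>Pow K - {{}}. ?l x Z)"
      using fin disj by (intro sum.union_disjoint) auto
    also have "(\<Sum>Z\<in>Pow A. ?l x Z) = (\<Sum>Z\<in>Pow A. ?l (restrict x A) Z)"
      by (intro sum.cong refl) (auto simp: Int_absorb1)
    also have "(\<Sum>Z\<in>Pow K - {{}}. ?l x Z) = (\<Sum>Z\<in>Pow K - {{}}. ?l (restrict x K) Z)"
      by (intro sum.cong refl) (auto simp: Int_absorb1)
    finally have "exp (ln (pmf ?q x)) = G (restrict x A) * H (restrict x K)"
      by (simp only: G_def H_def exp_add)
    moreover have "pmf ?q x > 0"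
      using x p by (simp add: pmf_positive_iff)
    ultimately show ?thesis by simp
  qed
  then have "pmf ?q x = pmf (marginal ?q A) (restrict x A) * pmf (marginal ?q K) (restrict x K)"
    by (intro product_form_marginals[OF fin disj p _ x])
  then show ?thesis
    by (simp add: marginal_marginal)
qed

theorem theorem4p2:
  fixes V M A B C :: "'v set"
    and k :: "'v \<Rightarrow> nat"
    and p :: "('v \<Rightarrow> nat) pmf"
  assumes "finite V"
    and "set_pmf p = table k V"
    and "M \<subseteq> V"
    and "partition_on M {A, B, C}"
    and "distinct [A, B, C]"
  shows "(\<forall>B' C'. B' \<noteq> {} \<and> B' \<subseteq> B \<and> C' \<noteq> {} \<and> C' \<subseteq> C \<longrightarrow>
            strictly_collapsible k p M (B \<union> C) B' \<and>
            strictly_collapsible k p M (B \<union> C) C' \<and>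
            strictly_collapsible k p M (B \<union> C) (B' \<union> C'))
         \<longleftrightarrow> joint_indep k p A B C"
proof -
  let ?K = "B \<union> C"
  have M: "M = A \<union> ?K" and ne: "B \<noteq> {}" "C \<noteq> {}" and disj: "A \<inter> ?K = {}"
    using assms(4,5) by (auto simp: partition_on_def disjoint_def)
  have fin: "finite (A \<union> ?K)"
    using assms(1,3) M finite_subset by metis
  have p: "set_pmf (marginal p (A \<union> ?K)) = table k (A \<union> ?K)"
    using set_pmf_marginal[OF assms(2,3)] M by simp
  show ?thesis
  proof
    assume coll: "\<forall>B' C'. B' \<noteq> {} \<and> B' \<subseteq> B \<and> C' \<noteq> {} \<and> C' \<subseteq> C \<longrightarrow>
        strictly_collapsible k p M ?K B' \<and> strictly_collapsible k p M ?K C' \<and>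
        strictly_collapsible k p M ?K (B' \<union> C')"
    have "mll k p Z (A \<union> ?K) x = 0"
      if Z: "Z \<subseteq> A \<union> ?K" "\<not> Z \<subseteq> A" "\<not> Z \<subseteq> ?K" and x: "x \<in> table k Z" for Z x
    proof -
      obtain b where b: "b \<in> Z" "b \<in> ?K"
        using Z by auto
      \<comment> \<open>The set for the block that does not contain \<open>b\<close> is arbitrary: the whole block will do.\<close>
      have "strictly_collapsible k p M ?K {b}"
        using b(2) coll[rule_format, of "{b}" C] coll[rule_format, of B "{b}"] ne by auto
      moreover have "{b} \<subset> Z"
        using b Z(3) by auto
      ultimately show ?thesis
        using Z x unfolding strictly_collapsible_def M by blast
    qed
    then show "joint_indep k p A B C"
      unfolding joint_indep_def Un_assoc
      using no_mixed_interaction_imp_independent_blocks[OF fin disj p] by blast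
  next
    assume "joint_indep k p A B C"
    then have "strictly_collapsible k p M ?K L" if "L \<noteq> {}" "L \<subseteq> ?K" for L
      unfolding M joint_indep_def Un_assoc
      using that independent_blocks_imp_strictly_collapsible[OF fin disj p] by blast
    then show "\<forall>B' C'. B' \<noteq> {} \<and> B' \<subseteq> B \<and> C' \<noteq> {} \<and> C' \<subseteq> C \<longrightarrow>
        strictly_collapsible k p M ?K B' \<and> strictly_collapsible k p M ?K C' \<and>
        strictly_collapsible k p M ?K (B' \<union> C')"
      by (auto simp: le_supI1 le_supI2)
  qed
qed

end
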